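(* Let $X$ be a locally Hausdorff, everywhere non-Hausdorff topological space. Let $A\subset U\subset X$ be such that $U$ is open and Hausdorff and $A$ is $\kappa$-Baire in $X$ for some cardinal $\kappa\ge\omega_1$. Let $S$ be a scan of $A$ in $X$. Then $S$ cannot be covered by fewer than $\kappa$ many open Hausdorff subsets of $X$.
   Context: A space is locally Hausdorff if each point has a Hausdorff neighborhood. Two points are separated if they have disjoint open neighborhoods; $NH(x)$ is the set of points $y\neq x$ of $X$ which cannot be separated from $x$, and $NH(A)=\bigcup_{x\in A}NH(x)$. $X$ is everywhere non-Hausdorff if $NH(x)\neq\varnothing$ for all $x\in X$. A subspace $A$ of $X$ is $\kappa$-Baire in $X$ if it cannot be covered by fewer than $\kappa$ nowhere dense subsets of $X$. If $Y\subset X$ satisfies $Y\cap NH(Y)=\varnothing$ (which is automatic when $Y$ is contained in an open Hausdorff set), a scan of $Y$ in $X$ is a subset $S\subset NH(Y)$ such that for each $x\in Y$: $NH(x)\neq\varnothing$ if and only if $NH(x)\cap S\neq\varnothing$. *)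

theory Defs
  imports "HOL-Analysis.Analysis"
begin

unbundle cardinal_syntax

definition locally_Hausdorff :: "'a topology \<Rightarrow> bool" where
  "locally_Hausdorff X \<longleftrightarrow>
     (\<forall>x \<in> topspace X. \<exists>V N. openin X V \<and> x \<in> V \<and> V \<subseteq> N \<and> N \<subseteq> topspace X \<and>
        Hausdorff_space (subtopology X N))"

definition separated_points :: "'a topology \<Rightarrow> 'a \<Rightarrow> 'a \<Rightarrow> bool" where
  "separated_points X x y \<longleftrightarrow>
     (\<exists>V W. openin X V \<and> openin X W \<and> x \<in> V \<and> y \<in> W \<and> disjnt V W)"

definition NH :: "'a topology \<Rightarrow> 'a \<Rightarrow> 'a set" where
  "NH X x = {y \<in> topspace X. y \<noteq> x \<and> \<not> separated_points X x y}"

definition NH_set :: "'a topology \<Rightarrow> 'a set \<Rightarrow> 'a set" where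
  "NH_set X A = (\<Union>x\<in>A. NH X x)"

definition everywhere_non_Hausdorff :: "'a topology \<Rightarrow> bool" where
  "everywhere_non_Hausdorff X \<longleftrightarrow> (\<forall>x \<in> topspace X. NH X x \<noteq> {})"

definition nowhere_dense_in :: "'a topology \<Rightarrow> 'a set \<Rightarrow> bool" where
  "nowhere_dense_in X N \<longleftrightarrow> N \<subseteq> topspace X \<and> X interior_of (X closure_of N) = {}"

(* Cardinals are represented as in the library, by cardinal orders: the intended use is with
   Card_order k. *)

definition Baire_in :: "'k rel \<Rightarrow> 'a topology \<Rightarrow> 'a set \<Rightarrow> bool" where
  "Baire_in k X A \<longleftrightarrow> A \<subseteq> topspace X \<and>
     \<not> (\<exists>\<N>. |\<N>| <o k \<and> (\<forall>N\<in>\<N>. nowhere_dense_in X N) \<and> A \<subseteq> \<Union>\<N>)"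

(* The first two conjuncts are the condition on Y under which scans of Y are defined at all. *)

definition scan_of :: "'a topology \<Rightarrow> 'a set \<Rightarrow> 'a set \<Rightarrow> bool" where
  "scan_of X Y S \<longleftrightarrow> Y \<subseteq> topspace X \<and> Y \<inter> NH_set X Y = {} \<and> S \<subseteq> NH_set X Y \<and>
     (\<forall>x\<in>Y. NH X x \<noteq> {} \<longleftrightarrow> NH X x \<inter> S \<noteq> {})"

end

theory Submission
  imports Defs
begin

text \<open>
  Suppose that a family of open Hausdorff sets covers the scan. Each point \<open>x\<close> of \<open>A\<close> has some
  non-separated partner in the scan, and this partner lies in a member \<open>V\<close> of the family. Then every
  neighbourhood of \<open>x\<close> meets \<open>V\<close>, while \<open>x\<close> itself is outside \<open>V\<close> because \<open>V\<close> is Hausdorff; so \<open>x\<close>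
  lies on the frontier of \<open>V\<close> (\<open>NH_meets_open_Hausdorff_imp_frontier\<close>). Frontiers of open sets are
  nowhere dense (\<open>nowhere_dense_frontier_of_open\<close>), hence \<open>A\<close> is covered by at most as many nowhere dense
  sets as the family has members, and the Baire property of \<open>A\<close> says that fewer than \<open>\<kappa>\<close> of them
  cannot suffice.
\<close>

text \<open>
  An open set inside the frontier of \<open>V\<close> avoids the open set \<open>V\<close>, yet each of its points is in the
  closure of \<open>V\<close>; such a set has no points.
\<close>

lemma nowhere_dense_frontier_of_open:
  assumes "openin X V"
  shows "nowhere_dense_in X (X frontier_of V)"
proof -
  have "X interior_of (X frontier_of V) = {}"
  proof (rule ccontr)
    let ?W = "X interior_of (X frontier_of V)"
    assume "?W \<noteq> {}"
    then obtain x where x: "x \<in> ?W" by blast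
    have sub: "?W \<subseteq> X closure_of V - V"
      using interior_of_subset[of X "X frontier_of V"] assms
      by (simp add: frontier_of_def interior_of_openin)
    then have "x \<in> X closure_of V" using x by blast
    then obtain y where "y \<in> V" "y \<in> ?W"
      using x openin_interior_of[of X "X frontier_of V"] unfolding in_closure_of by blast
    then show False using sub by blast
  qed
  then show ?thesis
    by (simp add: nowhere_dense_in_def frontier_of_subset_topspace closure_of_closedin
        closedin_frontier_of)
qed

lemma Hausdorff_open_imp_separated_points:
  assumes "openin X V" "Hausdorff_space (subtopology X V)"
    and "x \<in> V" "y \<in> V" "x \<noteq> y"
  shows "separated_points X x y"
proof -
  have "x \<in> topspace (subtopology X V)" "y \<in> topspace (subtopology X V)"
    using assms openin_subset by fastforce+
  then obtain P Q where "openin (subtopology X V) P" "openin (subtopology X V) Q"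
      "x \<in> P" "y \<in> Q" "disjnt P Q"
    using assms(2,5) unfolding Hausdorff_space_def by metis
  then show ?thesis
    using assms(1) unfolding separated_points_def
    by (meson openin_open_subtopology)
qed

lemma NH_meets_open_Hausdorff_imp_frontier:
  assumes "openin X V" "Hausdorff_space (subtopology X V)"
    and "x \<in> topspace X" "y \<in> NH X x" "y \<in> V"
  shows "x \<in> X frontier_of V"
proof -
  have y: "y \<noteq> x" "\<not> separated_points X x y"
    using assms(4) by (auto simp: NH_def)
  then have "x \<notin> V"
    using Hausdorff_open_imp_separated_points assms by metis
  moreover have "x \<in> X closure_of V"
    using y(2) assms(1,3,5) unfolding separated_points_def in_closure_of disjnt_iff by metis
  ultimately show ?thesis
    using assms(1) by (simp add: frontier_of_def interior_of_openin)
qed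

theorem theorem3p3:
  fixes X :: "'a topology" and A U S :: "'a set" and \<kappa> :: "'k rel"
  assumes "locally_Hausdorff X"
    and "everywhere_non_Hausdorff X"
    and "A \<subseteq> U"
    and "openin X U"
    and "Hausdorff_space (subtopology X U)"
    and "Card_order \<kappa>"
    and "cardSuc natLeq \<le>o \<kappa>"
    and "Baire_in \<kappa> X A"
    and "scan_of X A S"
  shows "\<not> (\<exists>\<V>. |\<V>| <o \<kappa> \<and>
              (\<forall>V\<in>\<V>. openin X V \<and> Hausdorff_space (subtopology X V)) \<and> S \<subseteq> \<Union>\<V>)"
proof
  assume "\<exists>\<V>. |\<V>| <o \<kappa> \<and>
              (\<forall>V\<in>\<V>. openin X V \<and> Hausdorff_space (subtopology X V)) \<and> S \<subseteq> \<Union>\<V>"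
  then obtain \<V> where small: "|\<V>| <o \<kappa>"
    and V: "\<And>V. V \<in> \<V> \<Longrightarrow> openin X V \<and> Hausdorff_space (subtopology X V)"
    and cover: "S \<subseteq> \<Union>\<V>"
    by blast
  let ?\<N> = "(\<lambda>V. X frontier_of V) ` \<V>"
  have "|?\<N>| <o \<kappa>"
    using card_of_image small by (rule ordLeq_ordLess_trans)
  moreover have "\<forall>N\<in>?\<N>. nowhere_dense_in X N"
    using V nowhere_dense_frontier_of_open by auto
  moreover have "A \<subseteq> \<Union>?\<N>"
  proof
    fix x assume "x \<in> A"
    then have x: "x \<in> topspace X"
      using assms(9) by (auto simp: scan_of_def)
    then have "NH X x \<inter> S \<noteq> {}"
      using \<open>x \<in> A\<close> assms(2,9) unfolding scan_of_def everywhere_non_Hausdorff_def by metis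
    then obtain y W where "y \<in> NH X x" "y \<in> W" "W \<in> \<V>"
      using cover by blast
    then show "x \<in> \<Union>?\<N>"
      using V x NH_meets_open_Hausdorff_imp_frontier by fast
  qed
  ultimately show False
    using assms(8) unfolding Baire_in_def by blast
qed

end
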